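(* Let $\mu$ be a Borel probability measure on $\mathbb{C}$ with compact support $S$ such that for every compact $K\subset\mathbb{C}$, $$\sup_{z\in K}\int_S (\log|z-w|)^2\,d\mu(w)<\infty .$$ Let $U_\mu(z)=\int_S\log|z-w|\,d\mu(w)$ and $\Omega^-=\{z\in\mathbb{C}:U_\mu(z)<0\}$. Suppose $\Omega^-\neq\emptyset$ and let $\rho=\rho(\Omega^-)$ be its inradius. Let $X_1,X_2,\dots$ be i.i.d. random variables with distribution $\mu$, let $p_n(z)=\prod_{k=1}^n(z-X_k)$, $\Lambda_n=\{z\in\mathbb{C}:|p_n(z)|<1\}$, and let $\rho_n=\rho(\Lambda_n)$. Then $\liminf_{n\to\infty}\rho_n\ge\rho$ almost surely. Further, if $S\subseteq\Omega^-$, then $\rho_n\to\rho$ almost surely.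
   Context: The inradius $\rho(U)$ of a set $U\subset\mathbb{C}$ is the supremum of the radii of open disks contained in $U$. All the $p_n$ are built from the same sequence $(X_k)_{k\ge1}$ on one probability space. *)

theory Defs
  imports "HOL-Probability.Probability"
begin

definition measure_support :: "'a::topological_space measure \<Rightarrow> 'a set" where
  "measure_support \<mu> = {x. \<forall>V. open V \<and> x \<in> V \<longrightarrow> emeasure \<mu> V > 0}"

(* The square of log t for t \<ge> 0, with log 0 = -\<infinity>. The library's convention ln 0 = 0 would
   not do here: under it the integrability hypothesis below would permit atoms. *)
definition log_sq :: "real \<Rightarrow> ennreal" where
  "log_sq t = (if t = 0 then \<infinity> else ennreal ((ln t)\<^sup>2))"

definition log_sq_locally_bounded :: "complex measure \<Rightarrow> bool" where
  "log_sq_locally_bounded \<mu> \<longleftrightarrow>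
     (\<forall>K. compact K \<longrightarrow>
        (SUP z\<in>K. \<integral>\<^sup>+w\<in>measure_support \<mu>. log_sq (cmod (z - w)) \<partial>\<mu>) < \<infinity>)"

(* For a finite Borel measure satisfying log_sq_locally_bounded, w = z is a \<mu>-null set
   and the integrand is \<mu>-integrable, so this is the usual logarithmic potential and the value
   ln 0 = 0 plays no role. *)
definition log_potential :: "complex measure \<Rightarrow> complex \<Rightarrow> real" where
  "log_potential \<mu> z = (LINT w:measure_support \<mu>|\<mu>. ln (cmod (z - w)))"

definition neg_potential_set :: "complex measure \<Rightarrow> complex set" where
  "neg_potential_set \<mu> = {z. log_potential \<mu> z < 0}"

(* Values in [0, \<infinity>]: the inradius of a set containing no disk is 0, and a set containing
   arbitrarily large disks has inradius \<infinity>. *)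
definition inradius :: "complex set \<Rightarrow> ennreal" where
  "inradius U = (SUP r\<in>{r::real. 0 < r \<and> (\<exists>c. ball c r \<subseteq> U)}. ennreal r)"

definition random_poly :: "(nat \<Rightarrow> 'a \<Rightarrow> complex) \<Rightarrow> 'a \<Rightarrow> nat \<Rightarrow> complex \<Rightarrow> complex" where
  "random_poly X \<omega> n z = (\<Prod>k=1..n. z - X k \<omega>)"

definition lemniscate :: "(nat \<Rightarrow> 'a \<Rightarrow> complex) \<Rightarrow> 'a \<Rightarrow> nat \<Rightarrow> complex set" where
  "lemniscate X \<omega> n = {z. cmod (random_poly X \<omega> n z) < 1}"

end

theory Submission
  imports Defs "HOL-Complex_Analysis.Conformal_Mappings"
begin

text \<open>
  Replacing \<open>log |z - w|\<close> by \<open>log (max |z - w| \<epsilon>)\<close> makes the integrand bounded and Lipschitz in \<open>z\<close>, so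
  almost surely the empirical averages of the truncated logarithm converge to its \<open>\<mu>\<close>-integral for
  all \<open>z\<close> and all \<open>\<epsilon> = 1/(m+1)\<close> simultaneously. Everything after that is deterministic.

  The truncation bounds \<open>log |p\<^sub>n|\<close> from above, and the truncated potentials decrease to \<open>U\<^sub>\<mu>\<close>, so every
  compact subset of \<open>\<Omega>\<^sup>-\<close> lies in \<open>\<Lambda>\<^sub>n\<close> for large \<open>n\<close>; this gives the lower bound.

  Conversely, if \<open>S \<subseteq> \<Omega>\<^sup>-\<close> and infinitely many \<open>\<Lambda>\<^sub>n\<close> contain a disk of radius \<open>r\<close>, a limit disk has
  \<open>U\<^sub>\<mu> \<le> 0\<close>: a point with \<open>U\<^sub>\<mu> > 0\<close> lies off \<open>S\<close>, where the truncation is eventually exact. A zero of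
  \<open>U\<^sub>\<mu>\<close> in that disk would also be off \<open>S\<close>, hence an interior maximum of a harmonic function. Then
  \<open>U\<^sub>\<mu>\<close> vanishes near it, and by unique continuation on all of the plane, since the closure of the
  interior of \<open>U\<^sub>\<mu> = 0\<close> avoids \<open>S\<close>. This contradicts \<open>S \<noteq> {}\<close>, so the disk lies in \<open>\<Omega>\<^sup>-\<close>.
\<close>

section \<open>Strong law of large numbers for bounded variables\<close>

text \<open>Hoeffding's inequality bounds the probability of a deviation of at least
  \<open>e\<close> by a geometric sequence in \<open>n\<close>, so Borel-Cantelli applies for each
  tolerance; the tolerances 1/(j+1) are countably many.\<close>

lemma (in prob_space) bounded_strong_law:
  fixes Y :: "nat \<Rightarrow> 'a \<Rightarrow> real"
  assumes indep: "indep_vars (\<lambda>_. borel) Y {1..}"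
    and bounded: "\<And>k. k \<ge> 1 \<Longrightarrow> AE \<omega> in M. \<bar>Y k \<omega>\<bar> \<le> B"
    and mean: "\<And>k. k \<ge> 1 \<Longrightarrow> expectation (Y k) = c"
  shows "AE \<omega> in M. (\<lambda>n. (\<Sum>k=1..n. Y k \<omega>) / real n) \<longlonglongrightarrow> c"
proof -
  \<comment> \<open>Adding 1 keeps the interval [-C, C] nondegenerate, so the denominator in
    Hoeffding's bound is positive whatever \<open>B\<close> is.\<close>
  define C where "C = \<bar>B\<bar> + 1"
  have "C > 0" by (simp add: C_def)
  have meas: "random_variable borel (Y k)" if "k \<ge> 1" for k
    using indep that by (simp add: indep_vars_def)
  have ev: "AE \<omega> in M. \<forall>\<^sub>F n in sequentially. \<bar>(\<Sum>k=1..n. Y k \<omega>) / real n - c\<bar> < inverse (real (Suc j))" for j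
  proof -
    define e where "e = inverse (real (Suc j))"
    have e: "e > 0" by (simp add: e_def)
    define A where "A = (\<lambda>n. {\<omega>\<in>space M. \<bar>(\<Sum>k=1..n. Y k \<omega>) - (\<Sum>k=1..n. expectation (Y k))\<bar> \<ge> real n * e})"
    have A_sets: "A n \<in> events" for n
    proof -
      have "random_variable borel (\<lambda>\<omega>. \<Sum>k=1..n. Y k \<omega>)"
        by (intro borel_measurable_sum) (auto intro: meas)
      then show ?thesis unfolding A_def by measurable
    qed
    have prob_A: "prob (A n) \<le> 2 * exp (- (e\<^sup>2 / (2 * C\<^sup>2))) ^ n" if "n \<ge> 1" for n
    proof -
      interpret H: Hoeffding_ineq M "{1..n}" Y "\<lambda>_. - C" "\<lambda>_. C" "\<Sum>k=1..n. expectation (Y k)"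
      proof (unfold_locales)
        show "indep_vars (\<lambda>_. borel) Y {1..n}"
          by (rule indep_vars_subset[OF indep]) auto
        show "AE \<omega> in M. Y k \<omega> \<in> {- C..C}" if "k \<in> {1..n}" for k
          using bounded[of k] that by (auto simp: C_def elim!: eventually_mono)
      qed auto
      have eq: "(\<Sum>k=1..n. (C - - C)\<^sup>2) = real n * (4 * C\<^sup>2)"
        by (simp add: power2_eq_square)
      have "prob (A n) \<le> 2 * exp (- 2 * (real n * e)\<^sup>2 / (\<Sum>k=1..n. (C - - C)\<^sup>2))"
        unfolding A_def
        by (rule H.Hoeffding_ineq_abs_ge) (use e that \<open>C > 0\<close> in \<open>simp_all add: eq\<close>)
      also have "- 2 * (real n * e)\<^sup>2 / (\<Sum>k=1..n. (C - - C)\<^sup>2) = real n * (- (e\<^sup>2 / (2 * C\<^sup>2)))"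
        unfolding eq using that \<open>C > 0\<close> by (simp add: field_simps power2_eq_square)
      finally show ?thesis by (simp only: exp_of_nat_mult)
    qed
    have "summable (\<lambda>n. 2 * exp (- (e\<^sup>2 / (2 * C\<^sup>2))) ^ n)"
      using e \<open>C > 0\<close> by (intro summable_mult summable_geometric) auto
    then have "summable (\<lambda>n. prob (A n))"
      by (rule summable_comparison_test'[where N = 1]) (use prob_A in auto)
    then have "AE \<omega> in M. \<forall>\<^sub>F n in sequentially. \<omega> \<in> space M - A n"
      using A_sets by (intro borel_cantelli_AE1) (auto simp: emeasure_eq_measure)
    then show ?thesis
    proof eventually_elim
      case (elim \<omega>)
      then show ?case
        using eventually_gt_at_top[of 0]
      proof eventually_elim
        case (elim n)
        have "(\<Sum>k=1..n. expectation (Y k)) = real n * c" by (simp add: mean)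
        with elim have "\<bar>(\<Sum>k=1..n. Y k \<omega>) - real n * c\<bar> < real n * e"
          by (auto simp: A_def)
        moreover have "(\<Sum>k=1..n. Y k \<omega>) / real n - c = ((\<Sum>k=1..n. Y k \<omega>) - real n * c) / real n"
          using elim by (simp add: field_simps)
        ultimately show ?case
          using elim unfolding e_def[symmetric] by (simp add: abs_divide divide_less_eq mult.commute)
      qed
    qed
  qed
  have "AE \<omega> in M. \<forall>j. \<forall>\<^sub>F n in sequentially. \<bar>(\<Sum>k=1..n. Y k \<omega>) / real n - c\<bar> < inverse (real (Suc j))"
    using ev by (simp add: AE_all_countable)
  then show ?thesis
  proof eventually_elim
    case (elim \<omega>)
    show ?case
    proof (rule tendstoI)
      fix r :: real assume "r > 0"
      then obtain j where "inverse (real (Suc j)) < r"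
        using reals_Archimedean by blast
      with elim[rule_format, of j]
      show "\<forall>\<^sub>F n in sequentially. dist ((\<Sum>k=1..n. Y k \<omega>) / real n) c < r"
        by (auto simp: dist_real_def elim: eventually_mono)
    qed
  qed
qed

section \<open>Maximum principle and inradius bounds\<close>

text \<open>Were \<open>f\<close> nonconstant, the image of \<open>A\<close> would be open and so
  contain a point to the right of \<open>f p\<close>. The maximum is taken only over
  \<open>A\<close>, yet constancy follows on all of \<open>V\<close>; this later serves as unique
  continuation.\<close>

lemma holomorphic_Re_max_imp_constant:
  assumes "f holomorphic_on V" "open V" "connected V" "open A" "A \<subseteq> V" "p \<in> A"
    and max: "\<And>z. z \<in> A \<Longrightarrow> Re (f z) \<le> Re (f p)"
  shows "f constant_on V"
proof (rule ccontr)
  assume "\<not> f constant_on V"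
  then have "open (f ` A)"
    using assms by (intro open_mapping_thm) auto
  then obtain e where e: "e > 0" "ball (f p) e \<subseteq> f ` A"
    using \<open>p \<in> A\<close> open_contains_ball by blast
  have "f p + of_real (e / 2) \<in> ball (f p) e"
    using e(1) by (simp add: dist_norm)
  then obtain z where "z \<in> A" "f z = f p + of_real (e / 2)"
    using e(2) by (metis imageE subsetD)
  with max[of z] e(1) show False by simp
qed

lemma ennreal_le_inradius: "ball c r \<subseteq> U \<Longrightarrow> ennreal r \<le> inradius U"
proof (cases "r > 0")
  case True
  then show "ball c r \<subseteq> U \<Longrightarrow> ennreal r \<le> inradius U"
    unfolding inradius_def by (intro SUP_upper) auto
qed (simp add: ennreal_neg)

text \<open>The supremum need not be attained; the strict inequality supplies a disk of some radius
  \<open>s\<close>, which is then shrunk.\<close>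

lemma less_inradiusE:
  assumes "ennreal r < inradius U"
  obtains c where "ball c r \<subseteq> U"
proof -
  from assms obtain s c where "0 < s" "ball c s \<subseteq> U" "ennreal r < ennreal s"
    unfolding inradius_def by (auto simp: less_SUP_iff)
  then have "r \<le> s"
    by (metis ennreal_leI linorder_not_less nle_le)
  then have "ball c r \<subseteq> U"
    using \<open>ball c s \<subseteq> U\<close> subset_ball by blast
  then show ?thesis by (rule that)
qed

section \<open>The truncated logarithm\<close>

text \<open>Indexing the cut-off by naturals keeps the almost sure statements within countable
  intersections. The argument of \<open>ln\<close> stays positive, so the value
  \<open>ln 0 = 0\<close> never enters.\<close>

definition trunc_log :: "nat \<Rightarrow> real \<Rightarrow> real" where
  "trunc_log m t = ln (max t (inverse (real (Suc m))))"

text \<open>Taking the maximum with 1/(m+1) does not increase distances, and \<open>ln\<close> has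
  slope at most m+1 to the right of the cut-off.\<close>

lemma trunc_log_lipschitz: "\<bar>trunc_log m s - trunc_log m t\<bar> \<le> real (Suc m) * \<bar>s - t\<bar>"
proof -
  have *: "trunc_log m s - trunc_log m t \<le> real (Suc m) * \<bar>s - t\<bar>" for s t
  proof -
    define e where "e = inverse (real (Suc m))"
    have e: "e > 0" by (simp add: e_def)
    have "trunc_log m s - trunc_log m t \<le> (max s e - max t e) / max t e"
      unfolding trunc_log_def e_def[symmetric] using e by (intro ln_diff_le) auto
    also have "\<dots> \<le> \<bar>s - t\<bar> / max t e"
      using e by (intro divide_right_mono) auto
    also have "\<dots> \<le> \<bar>s - t\<bar> / e"
      using e by (intro divide_left_mono) auto
    finally show ?thesis by (simp add: e_def divide_inverse mult.commute)
  qed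
  show ?thesis using *[of s t] *[of t s] by (simp only: abs_le_iff abs_minus_commute minus_diff_eq)
qed

lemma trunc_log_dist_lipschitz:
  "\<bar>trunc_log m (cmod (y - w)) - trunc_log m (cmod (z - w))\<bar> \<le> real (Suc m) * dist y z"
proof -
  have "\<bar>cmod (y - w) - cmod (z - w)\<bar> \<le> dist y z"
    using norm_triangle_ineq3[of "y - w" "z - w"] by (simp add: dist_norm)
  then show ?thesis
    by (intro order_trans[OF trunc_log_lipschitz] mult_left_mono) auto
qed

lemma isCont_trunc_log: "isCont (trunc_log m) t"
  unfolding trunc_log_def by (intro continuous_intros) (auto simp: max_def)

lemma continuous_on_trunc_log [continuous_intros]:
  "continuous_on A g \<Longrightarrow> continuous_on A (\<lambda>x. trunc_log m (g x))"
  by (rule continuous_on_compose2[of UNIV "trunc_log m"])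
     (simp_all add: continuous_at_imp_continuous_on isCont_trunc_log)

lemma ln_le_trunc_log: "t > 0 \<Longrightarrow> ln t \<le> trunc_log m t"
  by (auto simp: trunc_log_def)

text \<open>This form also covers \<open>t = 0\<close>, so zeros of the polynomial need no separate
  treatment.\<close>

lemma le_exp_trunc_log: "t \<le> exp (trunc_log m t)"
proof -
  have "max t (inverse (real (Suc m))) > 0" by (simp add: less_max_iff_disj)
  then show ?thesis unfolding trunc_log_def by (simp only: exp_ln max.cobounded1)
qed

lemma trunc_log_eq: "inverse (real (Suc m)) \<le> t \<Longrightarrow> trunc_log m t = ln t"
  by (simp add: trunc_log_def max_def)

text \<open>The cut-off is at most 1, so below it \<open>ln t \<le> trunc_log m t \<le> 0\<close>.
  Hence the absolute value of the logarithm dominates for all \<open>m\<close> at once.\<close>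

lemma abs_trunc_log_le:
  assumes "t > 0"
  shows "\<bar>trunc_log m t\<bar> \<le> \<bar>ln t\<bar>"
proof (cases "inverse (real (Suc m)) \<le> t")
  case False
  have "inverse (real (Suc m)) \<le> 1" by (simp add: field_simps)
  then have "trunc_log m t \<le> 0"
    using False assms by (simp add: trunc_log_def)
  with ln_le_trunc_log[OF assms, of m] show ?thesis by linarith
qed (simp add: trunc_log_eq)

lemma tendsto_trunc_log:
  assumes "t > 0"
  shows "(\<lambda>m. trunc_log m t) \<longlonglongrightarrow> ln t"
proof -
  have "\<forall>\<^sub>F m in sequentially. inverse (real (Suc m)) < t"
    using LIMSEQ_inverse_real_of_nat assms by (rule order_tendstoD)
  then have "\<forall>\<^sub>F m in sequentially. trunc_log m t = ln t"
    by eventually_elim (simp add: trunc_log_eq)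
  then show ?thesis by (rule tendsto_eventually)
qed

text \<open>The constant depends neither on \<open>n\<close> nor on the points \<open>x k\<close>;
  this is what extends convergence from a dense set to every point.\<close>

lemma average_trunc_log_lipschitz:
  "\<bar>(\<Sum>k=1..n. trunc_log m (cmod (y - x k))) / real n
    - (\<Sum>k=1..n. trunc_log m (cmod (z - x k))) / real n\<bar> \<le> real (Suc m) * dist y z"
proof (cases "n = 0")
  case False
  have "\<bar>(\<Sum>k=1..n. trunc_log m (cmod (y - x k))) - (\<Sum>k=1..n. trunc_log m (cmod (z - x k)))\<bar>
      \<le> (\<Sum>k=1..n. \<bar>trunc_log m (cmod (y - x k)) - trunc_log m (cmod (z - x k))\<bar>)"
    by (simp only: sum_subtractf[symmetric] sum_abs)
  also have "\<dots> \<le> (\<Sum>k=1..n. real (Suc m) * dist y z)"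
    by (intro sum_mono trunc_log_dist_lipschitz)
  finally show ?thesis
    using False by (simp add: diff_divide_distrib[symmetric] abs_divide divide_le_eq mult.commute)
qed simp

lemma measurable_trunc_log [measurable]: "trunc_log m \<in> borel_measurable borel"
  unfolding trunc_log_def[abs_def] by measurable

lemma measurable_log_sq [measurable]: "log_sq \<in> borel_measurable borel"
  unfolding log_sq_def[abs_def] by measurable

section \<open>Support, atoms and integrability\<close>

locale log_sq_measure = prob_space \<mu> for \<mu> :: "complex measure" +
  assumes sets_borel [measurable_cong]: "sets \<mu> = sets borel"
    and compact_support: "compact (measure_support \<mu>)"
    and log_sq_bounded: "log_sq_locally_bounded \<mu>"
begin

abbreviation S :: "complex set" where "S \<equiv> measure_support \<mu>"

lemma S_sets [measurable]: "S \<in> sets \<mu>"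
  using compact_support by (simp add: sets_borel compact_imp_closed)

text \<open>The complement of the support is a union of open null sets, and by Lindelof countably
  many of them already cover it.\<close>

lemma AE_support: "AE w in \<mu>. w \<in> S"
proof -
  define F where "F = {V. open V \<and> emeasure \<mu> V = 0}"
  obtain F' where F': "F' \<subseteq> F" "countable F'" "\<Union>F' = \<Union>F"
    using Lindelof[of F] by (auto simp: F_def)
  have "- S = \<Union>F"
    by (auto simp: F_def measure_support_def zero_less_iff_neq_zero)
  moreover have "(\<Union>V\<in>F'. V) \<in> null_sets \<mu>"
    using F' by (intro null_sets_UN') (auto simp: F_def null_sets_def sets_borel)
  ultimately show ?thesis
    using F' by (intro AE_I'[of "- S"]) auto
qed

lemma S_nonempty: "S \<noteq> {}"
proof
  assume "S = {}"
  with AE_support have "AE w in \<mu>. False" by simp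
  then show False by simp
qed

lemma log_sq_finite: "(\<integral>\<^sup>+w. log_sq (cmod (z - w)) \<partial>\<mu>) < \<infinity>"
proof -
  have "(\<integral>\<^sup>+w. log_sq (cmod (z - w)) \<partial>\<mu>) = (\<integral>\<^sup>+w\<in>S. log_sq (cmod (z - w)) \<partial>\<mu>)"
    using AE_support by (intro nn_integral_cong_AE) auto
  also have "\<dots> < \<infinity>"
    using log_sq_bounded[unfolded log_sq_locally_bounded_def, rule_format, of "{z}"] by simp
  finally show ?thesis .
qed

text \<open>An atom at \<open>z\<close> would make the integral of \<open>log_sq\<close> infinite,
  since \<open>log_sq 0\<close> is infinite.\<close>

lemma AE_neq: "AE w in \<mu>. w \<noteq> z"
proof -
  have "AE w in \<mu>. log_sq (cmod (z - w)) \<noteq> \<infinity>"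
    using log_sq_finite[of z] by (intro nn_integral_PInf_AE) auto
  then show ?thesis
    by eventually_elim (auto simp: log_sq_def)
qed

text \<open>The bound \<open>\<bar>x\<bar> \<le> 1 + x\<^sup>2\<close> reduces this to the finite
  integral of \<open>log_sq\<close>, as the constant 1 has integral 1.\<close>

lemma integrable_ln: "integrable \<mu> (\<lambda>w. ln (cmod (z - w)))"
proof (rule integrableI_bounded)
  have "(\<integral>\<^sup>+w. ennreal (norm (ln (cmod (z - w)))) \<partial>\<mu>) \<le> (\<integral>\<^sup>+w. 1 + log_sq (cmod (z - w)) \<partial>\<mu>)"
  proof (rule nn_integral_mono)
    fix w
    have "\<bar>x\<bar> \<le> 1 + x\<^sup>2" for x :: real
      using zero_le_power2[of "\<bar>x\<bar> - 1"] zero_le_power2[of x]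
      by (simp add: power2_diff)
    then have "ennreal \<bar>x\<bar> \<le> 1 + ennreal (x\<^sup>2)" for x :: real
      by (metis ennreal_1 ennreal_leI ennreal_plus zero_le_one zero_le_power2)
    then show "ennreal (norm (ln (cmod (z - w)))) \<le> 1 + log_sq (cmod (z - w))"
      by (auto simp: log_sq_def)
  qed
  also have "\<dots> < \<infinity>"
    using log_sq_finite[of z] by (simp add: nn_integral_add emeasure_space_1)
  finally show "(\<integral>\<^sup>+w. ennreal (norm (ln (cmod (z - w)))) \<partial>\<mu>) < \<infinity>" .
qed measurable

lemma log_potential_eq: "log_potential \<mu> z = (LINT w|\<mu>. ln (cmod (z - w)))"
  unfolding log_potential_def set_lebesgue_integral_def
proof (rule integral_cong_AE)
  show "AE w in \<mu>. indicator S w *\<^sub>R ln (cmod (z - w)) = ln (cmod (z - w))"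
    using AE_support by eventually_elim simp
qed measurable

section \<open>Truncated potentials\<close>

definition trunc_potential :: "nat \<Rightarrow> complex \<Rightarrow> real" where
  "trunc_potential m z = (LINT w|\<mu>. trunc_log m (cmod (z - w)))"

lemma integrable_trunc_log: "integrable \<mu> (\<lambda>w. trunc_log m (cmod (z - w)))"
proof (rule Bochner_Integration.integrable_bound[OF integrable_ln[of z]])
  show "AE w in \<mu>. norm (trunc_log m (cmod (z - w))) \<le> norm (ln (cmod (z - w)))"
    using AE_neq[of z] by eventually_elim (simp add: abs_trunc_log_le)
qed measurable

lemma log_potential_le_trunc: "log_potential \<mu> z \<le> trunc_potential m z"
  unfolding log_potential_eq trunc_potential_def
proof (intro integral_mono_AE integrable_ln integrable_trunc_log)
  show "AE w in \<mu>. ln (cmod (z - w)) \<le> trunc_log m (cmod (z - w))"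
    using AE_neq[of z] by eventually_elim (simp add: ln_le_trunc_log)
qed

lemma trunc_potential_tendsto: "(\<lambda>m. trunc_potential m z) \<longlonglongrightarrow> log_potential \<mu> z"
  unfolding log_potential_eq trunc_potential_def
proof (rule integral_dominated_convergence)
  show "integrable \<mu> (\<lambda>w. \<bar>ln (cmod (z - w))\<bar>)"
    using integrable_ln by (rule integrable_abs)
  show "AE w in \<mu>. (\<lambda>m. trunc_log m (cmod (z - w))) \<longlonglongrightarrow> ln (cmod (z - w))"
    using AE_neq[of z] by eventually_elim (simp add: tendsto_trunc_log)
  show "AE w in \<mu>. norm (trunc_log m (cmod (z - w))) \<le> \<bar>ln (cmod (z - w))\<bar>" for m
    using AE_neq[of z] by eventually_elim (simp add: abs_trunc_log_le)
qed measurable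

lemma trunc_potential_lipschitz:
  "\<bar>trunc_potential m y - trunc_potential m z\<bar> \<le> real (Suc m) * dist y z"
proof -
  have "\<bar>trunc_potential m y - trunc_potential m z\<bar>
      = norm (LINT w|\<mu>. trunc_log m (cmod (y - w)) - trunc_log m (cmod (z - w)))"
    by (simp add: trunc_potential_def integrable_trunc_log)
  also have "\<dots> \<le> (LINT w|\<mu>. real (Suc m) * dist y z)"
    using trunc_log_dist_lipschitz[of m y _ z]
    by (intro order_trans[OF integral_norm_bound] integral_mono)
       (auto intro!: integrable_trunc_log)
  finally show ?thesis by (simp add: prob_space)
qed

section \<open>Openness of the negative set, harmonicity and unique continuation\<close>

lemma neg_potential_trunc:
  assumes "log_potential \<mu> z < 0"
  obtains m where "trunc_potential m z < 0"
proof -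
  have "\<forall>\<^sub>F m in sequentially. trunc_potential m z < 0"
    using trunc_potential_tendsto assms by (rule order_tendstoD)
  then show ?thesis using that by (auto simp: eventually_sequentially)
qed

text \<open>A negative truncated potential stays negative on a ball by its Lipschitz bound, and it
  dominates the potential there; \<open>d\<close> is the radius at which that bound uses up the
  whole margin.\<close>

lemma open_neg_potential: "open (neg_potential_set \<mu>)"
  unfolding open_contains_ball
proof
  fix z assume "z \<in> neg_potential_set \<mu>"
  then obtain m where m: "trunc_potential m z < 0"
    using neg_potential_trunc by (auto simp: neg_potential_set_def)
  define d where "d = - trunc_potential m z / real (Suc m)"
  have "log_potential \<mu> y < 0" if "y \<in> ball z d" for y
  proof -
    have "real (Suc m) * dist y z < - trunc_potential m z"
      using that by (simp add: d_def dist_commute field_simps)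
    with trunc_potential_lipschitz[of m y z] log_potential_le_trunc[of y m] show ?thesis
      by linarith
  qed
  moreover have "d > 0" unfolding d_def using m by (intro divide_pos_pos) auto
  ultimately show "\<exists>e>0. ball z e \<subseteq> neg_potential_set \<mu>"
    by (auto simp: neg_potential_set_def)
qed

text \<open>\<open>f\<close> arises by integrating the series of \<open>Ln (1 - (z - z0) / (w - z0))\<close> term by term, using
  \<open>z - w = (z0 - w) (1 - (z - z0) / (w - z0))\<close>.\<close>
lemma log_potential_local_Re:
  assumes disj: "ball z0 d \<inter> S = {}"
  obtains f where "f holomorphic_on ball z0 d"
    "\<And>z. z \<in> ball z0 d \<Longrightarrow> log_potential \<mu> z = Re (f z)"
proof -
  \<comment> \<open>At \<open>n = 0\<close> division by zero makes the coefficient 0, matching the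
    missing constant term in the series of \<open>Ln (1 - u)\<close>; \<open>g\<close> below relies
    on the same convention.\<close>
  define a where "a = (\<lambda>n. LINT w|\<mu>. - 1 / (of_nat n * (w - z0) ^ n))"
  define f where "f = (\<lambda>z. LINT w|\<mu>. Ln (1 - (z - z0) / (w - z0)))"
  have AE_far: "AE w in \<mu>. cmod (w - z0) \<ge> d"
    using AE_support
    by eventually_elim (use disj in \<open>force simp: dist_norm norm_minus_commute\<close>)
  have key: "(\<lambda>n. a n * (z - z0) ^ n) sums f z"
    "integrable \<mu> (\<lambda>w. Ln (1 - (z - z0) / (w - z0)))"
    if z: "z \<in> ball z0 d" for z
  proof -
    have d: "d > 0" using z by (metis ball_eq_empty empty_iff not_le)
    \<comment> \<open>Almost every \<open>w\<close> is at distance at least \<open>d\<close> from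
      \<open>z0\<close>, so \<open>q < 1\<close> bounds the ratio uniformly in \<open>w\<close>. The
      powers of \<open>q\<close> are the majorant for interchanging sum and integral.\<close>
    define q where "q = cmod (z - z0) / d"
    have q: "0 \<le> q" "q < 1"
      using z d by (auto simp: q_def dist_norm norm_minus_commute)
    define g where "g = (\<lambda>n w. - (((z - z0) / (w - z0)) ^ n) / of_nat n)"
    have quot: "cmod ((z - z0) / (w - z0)) \<le> q" if "cmod (w - z0) \<ge> d" for w
      unfolding norm_divide q_def using that d by (intro divide_left_mono mult_pos_pos) auto
    have g_le: "cmod (g n w) \<le> q ^ n" if w: "cmod (w - z0) \<ge> d" for n w
    proof (cases "n = 0")
      case False
      have "cmod (g n w) = cmod ((z - z0) / (w - z0)) ^ n / real n"
        by (simp add: g_def norm_divide norm_power)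
      also have "\<dots> \<le> q ^ n / 1"
        using False q by (intro frac_le power_mono quot w) auto
      finally show ?thesis by simp
    qed (simp add: g_def q)
    have g_sums: "(\<lambda>n. g n w) sums Ln (1 - (z - z0) / (w - z0))" if "cmod (w - z0) \<ge> d" for w
      using Ln_series'[of "- ((z - z0) / (w - z0))"] quot[OF that] q
      by (simp add: g_def)
    have g_int: "integrable \<mu> (g n)" for n
    proof (rule integrable_const_bound[of _ "q ^ n"])
      show "AE w in \<mu>. norm (g n w) \<le> q ^ n"
        using AE_far by eventually_elim (rule g_le)
    qed (simp add: g_def)
    have sumq: "summable (\<lambda>n. q ^ n)" using q by (intro summable_geometric) auto
    have s1: "AE w in \<mu>. summable (\<lambda>n. norm (g n w))"
      using AE_far
      by eventually_elim (rule summable_comparison_test'[OF sumq, of 0], simp add: g_le)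
    have s2: "summable (\<lambda>n. LINT w|\<mu>. norm (g n w))"
    proof (rule summable_comparison_test'[OF sumq, of 0])
      fix n
      have "(LINT w|\<mu>. norm (g n w)) \<le> (LINT w|\<mu>. q ^ n)"
        using AE_far by (intro integral_mono_AE) (auto simp: g_le g_int elim!: eventually_mono)
      then show "norm (LINT w|\<mu>. norm (g n w)) \<le> q ^ n" by (simp add: prob_space)
    qed
    have suminf_eq: "AE w in \<mu>. (\<Sum>n. g n w) = Ln (1 - (z - z0) / (w - z0))"
      using AE_far by eventually_elim (rule sums_unique[symmetric, OF g_sums])
    have m1: "(\<lambda>w. \<Sum>n. g n w) \<in> borel_measurable \<mu>"
      using integrable_suminf[OF g_int s1 s2] by (rule borel_measurable_integrable)
    have m2: "(\<lambda>w. Ln (1 - (z - z0) / (w - z0))) \<in> borel_measurable \<mu>"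
      by measurable
    have "(\<lambda>n. LINT w|\<mu>. g n w) sums (LINT w|\<mu>. (\<Sum>n. g n w))"
      by (rule sums_integral[OF g_int s1 s2])
    also have "(LINT w|\<mu>. (\<Sum>n. g n w)) = f z"
      unfolding f_def by (rule integral_cong_AE[OF m1 m2 suminf_eq])
    also have "(\<lambda>n. LINT w|\<mu>. g n w) = (\<lambda>n. a n * (z - z0) ^ n)"
    proof
      fix n
      have "g n = (\<lambda>w. (- 1 / (of_nat n * (w - z0) ^ n)) * (z - z0) ^ n)"
        by (auto simp: g_def power_divide)
      then show "(LINT w|\<mu>. g n w) = a n * (z - z0) ^ n"
        by (simp only: a_def integral_mult_left_zero)
    qed
    finally show "(\<lambda>n. a n * (z - z0) ^ n) sums f z" .
    show "integrable \<mu> (\<lambda>w. Ln (1 - (z - z0) / (w - z0)))"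
      using integrable_suminf[OF g_int s1 s2] integrable_cong_AE[OF m1 m2 suminf_eq] by blast
  qed
  show ?thesis
  proof
    \<comment> \<open>The real part of \<open>f\<close> is only the difference from the potential at
      \<open>z0\<close>, hence the added constant.\<close>
    show "(\<lambda>z. of_real (log_potential \<mu> z0) + f z) holomorphic_on ball z0 d"
      by (intro holomorphic_intros power_series_holomorphic[of z0 d a]) (rule key(1))
    fix z assume z: "z \<in> ball z0 d"
    have ln_eq: "AE w in \<mu>. ln (cmod (z - w)) = ln (cmod (z0 - w)) + Re (Ln (1 - (z - z0) / (w - z0)))"
      using AE_neq[of z] AE_neq[of z0]
    proof eventually_elim
      case (elim w)
      have "z - w = (z0 - w) * (1 - (z - z0) / (w - z0))"
        using elim by (simp add: field_simps)
      moreover from this have "1 - (z - z0) / (w - z0) \<noteq> 0"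
        using elim by auto
      ultimately show ?case
        using elim by (simp add: norm_mult ln_mult)
    qed
    have "log_potential \<mu> z = (LINT w|\<mu>. ln (cmod (z0 - w)) + Re (Ln (1 - (z - z0) / (w - z0))))"
      unfolding log_potential_eq
      by (rule integral_cong_AE[OF _ _ ln_eq]) measurable
    also have "\<dots> = log_potential \<mu> z0 + Re (f z)"
      using key(2)[OF z] by (simp add: log_potential_eq f_def integrable_ln)
    finally show "log_potential \<mu> z = Re (of_real (log_potential \<mu> z0) + f z)" by simp
  qed
qed

text \<open>The set \<open>A\<close> is the whole ball when an interior maximum is excluded, and a
  smaller open set when zeros are continued across a ball.\<close>

lemma log_potential_eq_on_ball:
  assumes "ball z0 d \<inter> S = {}" "open A" "A \<subseteq> ball z0 d" "p \<in> A"
    and "\<And>z. z \<in> A \<Longrightarrow> log_potential \<mu> z \<le> log_potential \<mu> p"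
    and "z \<in> ball z0 d"
  shows "log_potential \<mu> z = log_potential \<mu> p"
proof -
  obtain f where f: "f holomorphic_on ball z0 d"
    "\<And>z. z \<in> ball z0 d \<Longrightarrow> log_potential \<mu> z = Re (f z)"
    using log_potential_local_Re[OF assms(1)] by blast
  have "f constant_on ball z0 d"
    using f(1) _ _ assms(2-4)
  proof (rule holomorphic_Re_max_imp_constant)
    show "Re (f z) \<le> Re (f p)" if "z \<in> A" for z
      using assms(3-5) that f(2) by (metis subsetD)
  qed auto
  then have "f z = f p"
    using assms unfolding constant_on_def by (metis subsetD)
  then show ?thesis using f(2) assms by auto
qed

lemma ball_subset_neg_potential:
  assumes S_neg: "S \<subseteq> neg_potential_set \<mu>"
    and nonpos: "\<And>z. z \<in> ball c r \<Longrightarrow> log_potential \<mu> z \<le> 0"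
  shows "ball c r \<subseteq> neg_potential_set \<mu>"
proof
  fix p assume p: "p \<in> ball c r"
  show "p \<in> neg_potential_set \<mu>"
  proof (rule ccontr)
    assume "p \<notin> neg_potential_set \<mu>"
    with nonpos[OF p] have p0: "log_potential \<mu> p = 0" and "p \<notin> S"
      using S_neg by (auto simp: neg_potential_set_def)
    have open_compl: "open (- S)"
      using compact_support by (simp add: compact_imp_closed open_Compl)
    \<comment> \<open>Taking the interior makes \<open>W\<close> open; it is shown to be nonempty
      and closed, hence the whole plane.\<close>
    define W where "W = interior {z. log_potential \<mu> z = 0}"
    have "open (ball c r \<inter> - S)" using open_compl by auto
    then obtain d where d: "d > 0" "ball p d \<subseteq> ball c r \<inter> - S"
      using p \<open>p \<notin> S\<close> open_contains_ball by blast
    have "log_potential \<mu> z = 0" if "z \<in> ball p d" for z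
      proof -
      have "log_potential \<mu> z = log_potential \<mu> p"
        by (rule log_potential_eq_on_ball[of p d "ball p d"])
           (use d that nonpos p0 in \<open>auto simp: subset_iff\<close>)
      with p0 show ?thesis by simp
    qed
    then have "p \<in> W"
      unfolding W_def using d by (intro interiorI[of "ball p d"]) auto
    moreover have "closed W"
      unfolding closure_subset_eq[symmetric]
    proof
      fix z0 assume z0: "z0 \<in> closure W"
      \<comment> \<open>The support lies in the open negative set, which misses \<open>W\<close> and
        therefore also its closure.\<close>
      have "z0 \<notin> S"
      proof
        assume "z0 \<in> S"
        then have "neg_potential_set \<mu> \<inter> W \<noteq> {}"
          using z0 S_neg open_neg_potential by (metis closure_iff_nhds_not_empty subsetD subset_refl Int_commute)
        then show False
          using interior_subset by (force simp: neg_potential_set_def W_def)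
      qed
      then obtain d where d: "d > 0" "ball z0 d \<subseteq> - S"
        using open_compl open_contains_ball by blast
      then obtain y where y: "y \<in> W \<inter> ball z0 d"
        using z0 by (metis centre_in_ball closure_iff_nhds_not_empty open_ball subset_refl ex_in_conv)
      have W0: "log_potential \<mu> z = 0" if "z \<in> W" for z
        using that interior_subset unfolding W_def by blast
      have "log_potential \<mu> z = 0" if "z \<in> ball z0 d" for z
      proof -
        \<comment> \<open>The potential vanishes on this open set, so each of its points is a
          maximum there, and the value 0 spreads to the whole ball.\<close>
        have "open (W \<inter> ball z0 d)" by (auto simp: W_def)
        then have "log_potential \<mu> z = log_potential \<mu> y"
          using d that y W0 by (intro log_potential_eq_on_ball[of z0 d "W \<inter> ball z0 d"]) auto
        with W0 y show ?thesis by simp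
      qed
      then show "z0 \<in> W"
        unfolding W_def using d by (intro interiorI[of "ball z0 d"]) auto
    qed
    ultimately have "W = UNIV"
      using clopen[of W] by (auto simp: W_def)
    then have "log_potential \<mu> z = 0" for z
      using interior_subset unfolding W_def by blast
    then show False
      using S_neg S_nonempty by (auto simp: neg_potential_set_def)
  qed
qed

section \<open>Sample sequences treated deterministically\<close>

text \<open>This collects all that is used about a random sample; the lemmas on lemniscates below
  concern one fixed \<open>\<omega>\<close>.\<close>

definition typical :: "(nat \<Rightarrow> complex) \<Rightarrow> bool" where
  "typical x \<longleftrightarrow> (\<forall>k\<ge>1. x k \<in> S) \<and>
     (\<forall>m z. (\<lambda>n. (\<Sum>k=1..n. trunc_log m (cmod (z - x k))) / real n) \<longlonglongrightarrow> trunc_potential m z)"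

lemma typicalI_dense:
  assumes "\<And>k. k \<ge> 1 \<Longrightarrow> x k \<in> S"
    and dense: "\<And>A :: complex set. open A \<Longrightarrow> A \<noteq> {} \<Longrightarrow> \<exists>d\<in>D. d \<in> A"
    and conv: "\<And>m d. d \<in> D \<Longrightarrow>
      (\<lambda>n. (\<Sum>k=1..n. trunc_log m (cmod (d - x k))) / real n) \<longlonglongrightarrow> trunc_potential m d"
  shows "typical x"
  unfolding typical_def
proof (intro conjI allI impI assms(1))
  fix m z
  let ?A = "\<lambda>n z. (\<Sum>k=1..n. trunc_log m (cmod (z - x k))) / real n"
  show "(\<lambda>n. ?A n z) \<longlonglongrightarrow> trunc_potential m z"
  proof (rule tendstoI)
    fix e :: real assume e: "e > 0"
    \<comment> \<open>Moving from \<open>z\<close> to \<open>d\<close> costs less than e/3 in the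
      average and in the potential; convergence at \<open>d\<close> costs the last third.\<close>
    define s where "s = e / (3 * real (Suc m))"
    have "s > 0" using e by (simp add: s_def)
    then obtain d where d: "d \<in> D" "d \<in> ball z s"
      using dense[of "ball z s"] by auto
    have sd: "real (Suc m) * dist d z < e / 3"
      using d(2) by (simp add: s_def dist_commute field_simps)
    have "\<forall>\<^sub>F n in sequentially. dist (?A n d) (trunc_potential m d) < e / 3"
      using conv[OF d(1)] e by (intro tendstoD) auto
    then show "\<forall>\<^sub>F n in sequentially. dist (?A n z) (trunc_potential m z) < e"
    proof eventually_elim
      case (elim n)
      show ?case
        using elim sd trunc_potential_lipschitz[of m d z] average_trunc_log_lipschitz[of m d x n z]
        unfolding dist_real_def by linarith
    qed
  qed
qed

lemma typical_eventually_ball: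
  assumes x: "typical (\<lambda>k. X k \<omega>)" and neg: "log_potential \<mu> z < 0"
  obtains d where "d > 0" "\<forall>\<^sub>F n in sequentially. ball z d \<subseteq> lemniscate X \<omega> n"
proof -
  obtain m where m: "trunc_potential m z < 0"
    using neg_potential_trunc[OF neg] by blast
  \<comment> \<open>The averages at \<open>z\<close> eventually fall below half of the negative
    limit; moving within distance \<open>d\<close> costs less than the other half.\<close>
  define d where "d = - trunc_potential m z / (2 * real (Suc m))"
  have "\<forall>\<^sub>F n in sequentially.
      (\<Sum>k=1..n. trunc_log m (cmod (z - X k \<omega>))) / real n < trunc_potential m z / 2"
    using x m unfolding typical_def by (intro order_tendstoD(2)) auto
  then have "\<forall>\<^sub>F n in sequentially. ball z d \<subseteq> lemniscate X \<omega> n"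
    using eventually_gt_at_top[of 0]
  proof eventually_elim
    case (elim n)
    show ?case
    proof
      fix y assume "y \<in> ball z d"
      then have "real (Suc m) * dist y z < - trunc_potential m z / 2"
        by (simp add: d_def dist_commute field_simps)
      with elim average_trunc_log_lipschitz[of m y "\<lambda>k. X k \<omega>" n z]
      have "(\<Sum>k=1..n. trunc_log m (cmod (y - X k \<omega>))) / real n < 0"
        by linarith
      then have neg: "(\<Sum>k=1..n. trunc_log m (cmod (y - X k \<omega>))) < 0"
        using elim by (simp add: divide_less_0_iff)
      have "cmod (random_poly X \<omega> n y) = (\<Prod>k=1..n. cmod (y - X k \<omega>))"
        by (simp add: random_poly_def prod_norm)
      also have "\<dots> \<le> (\<Prod>k=1..n. exp (trunc_log m (cmod (y - X k \<omega>))))"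
        by (intro prod_mono conjI norm_ge_zero le_exp_trunc_log)
      also have "\<dots> = exp (\<Sum>k=1..n. trunc_log m (cmod (y - X k \<omega>)))"
        by (simp add: exp_sum)
      also have "\<dots> < 1" using neg by simp
      finally show "y \<in> lemniscate X \<omega> n" by (simp add: lemniscate_def)
    qed
  qed
  moreover have "d > 0" unfolding d_def using m by (intro divide_pos_pos) auto
  ultimately show ?thesis using that by blast
qed

lemma typical_eventually_compact:
  assumes x: "typical (\<lambda>k. X k \<omega>)" and K: "compact K" "K \<subseteq> neg_potential_set \<mu>"
  shows "\<forall>\<^sub>F n in sequentially. K \<subseteq> lemniscate X \<omega> n"
proof -
  have "\<exists>d>0. \<forall>\<^sub>F n in sequentially. ball z d \<subseteq> lemniscate X \<omega> n" if "z \<in> K" for z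
    using typical_eventually_ball[of X \<omega> z, OF x] that K by (auto simp: neg_potential_set_def)
  then obtain d where d: "\<And>z. z \<in> K \<Longrightarrow> d z > 0"
    "\<And>z. z \<in> K \<Longrightarrow> \<forall>\<^sub>F n in sequentially. ball z (d z) \<subseteq> lemniscate X \<omega> n"
    by metis
  have "K \<subseteq> (\<Union>z\<in>K. ball z (d z))" using d(1) by force
  then obtain F where F: "F \<subseteq> K" "finite F" "K \<subseteq> (\<Union>z\<in>F. ball z (d z))"
    using compactE_image[OF K(1), of K "\<lambda>z. ball z (d z)"] by auto
  have "\<forall>\<^sub>F n in sequentially. \<forall>z\<in>F. ball z (d z) \<subseteq> lemniscate X \<omega> n"
    using F d by (intro eventually_ball_finite) auto
  then show ?thesis
    by eventually_elim (use F in blast)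
qed

lemma typical_liminf_inradius:
  assumes x: "typical (\<lambda>k. X k \<omega>)"
  shows "inradius (neg_potential_set \<mu>) \<le> liminf (\<lambda>n. inradius (lemniscate X \<omega> n))"
proof (rule dense_le)
  fix y assume y: "y < inradius (neg_potential_set \<mu>)"
  then have "y < top" using less_top top.extremum_strict by fastforce
  then obtain s where s: "y = ennreal s" "s \<ge> 0" by (cases y) auto
  \<comment> \<open>An intermediate radius is needed because only compact sets are eventually
    absorbed: the closed disk of radius \<open>s\<close> fits inside the open disk of radius
    \<open>t\<close>.\<close>
  obtain y' where y': "y < y'" "y' < inradius (neg_potential_set \<mu>)"
    using y dense by blast
  then have "y' < top" using less_top top.extremum_strict by fastforce
  then obtain t where t: "y' = ennreal t" by (cases y') auto
  have "s < t" using y' s t by (simp add: ennreal_less_iff)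
  obtain c where c: "ball c t \<subseteq> neg_potential_set \<mu>"
    using less_inradiusE y' t by metis
  have "cball c s \<subseteq> ball c t" using \<open>s < t\<close> by auto
  then have "\<forall>\<^sub>F n in sequentially. cball c s \<subseteq> lemniscate X \<omega> n"
    using c by (intro typical_eventually_compact x) auto
  then have "\<forall>\<^sub>F n in sequentially. y \<le> inradius (lemniscate X \<omega> n)"
    unfolding s(1) by eventually_elim (meson ball_subset_cball ennreal_le_inradius order_trans)
  then show "y \<le> liminf (\<lambda>n. inradius (lemniscate X \<omega> n))"
    by (rule Liminf_bounded)
qed

text \<open>With the cut-off below the distance from \<open>z\<close> to the support, truncation
  changes no factor, so the averages control the polynomial from below as well.\<close>

lemma typical_eventually_notin_lemniscate:
  assumes x: "typical (\<lambda>k. X k \<omega>)" and pos: "log_potential \<mu> z > 0" and "z \<notin> S"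
  shows "\<forall>\<^sub>F n in sequentially. z \<notin> lemniscate X \<omega> n"
proof -
  have "open (- S)"
    using compact_support by (simp add: compact_imp_closed open_Compl)
  then obtain d where d: "d > 0" "ball z d \<subseteq> - S"
    using \<open>z \<notin> S\<close> open_contains_ball by blast
  obtain m where m: "inverse (real (Suc m)) < d"
    using reals_Archimedean[OF d(1)] by blast
  have far: "cmod (z - w) \<ge> d" if "w \<in> S" for w
    using that d by (auto simp: dist_norm not_less[symmetric])
  have ln_eq: "trunc_log m (cmod (z - w)) = ln (cmod (z - w))" if "w \<in> S" for w
    using far[OF that] m by (intro trunc_log_eq) auto
  have "trunc_potential m z = log_potential \<mu> z"
    unfolding trunc_potential_def log_potential_eq
    using AE_support by (intro integral_cong_AE) (auto simp: ln_eq elim!: eventually_mono)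
  then have "\<forall>\<^sub>F n in sequentially. 0 < (\<Sum>k=1..n. trunc_log m (cmod (z - X k \<omega>))) / real n"
    using x pos unfolding typical_def by (intro order_tendstoD(1)[of _ "log_potential \<mu> z"]) metis+
  then show ?thesis
  proof eventually_elim
    case (elim n)
    have X: "X k \<omega> \<in> S" if "k \<in> {1..n}" for k
      using x that by (auto simp: typical_def)
    have "0 < (\<Sum>k=1..n. trunc_log m (cmod (z - X k \<omega>)))"
      using elim by (simp add: zero_less_divide_iff)
    then have "1 < exp (\<Sum>k=1..n. trunc_log m (cmod (z - X k \<omega>)))" by simp
    also have "\<dots> = (\<Prod>k=1..n. exp (trunc_log m (cmod (z - X k \<omega>))))"
      by (simp add: exp_sum)
    also have "\<dots> = (\<Prod>k=1..n. cmod (z - X k \<omega>))"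
      using X far d(1) by (intro prod.cong) (force simp: ln_eq)+
    also have "\<dots> = cmod (random_poly X \<omega> n z)"
      by (simp add: random_poly_def prod_norm)
    finally show ?case by (simp add: lemniscate_def)
  qed
qed

text \<open>A point at distance at least 1 from all samples makes every factor at least 1. The bound
  is uniform in \<open>n\<close>, so centres of disks in the lemniscates have a convergent
  subsequence.\<close>

lemma lemniscate_bounded:
  assumes "typical (\<lambda>k. X k \<omega>)"
  shows "bounded (\<Union>n. lemniscate X \<omega> n)"
proof -
  obtain R where R: "\<And>w. w \<in> S \<Longrightarrow> cmod w \<le> R"
    using compact_imp_bounded[OF compact_support] by (auto simp: bounded_iff)
  have "cmod z < R + 1" if z: "z \<in> lemniscate X \<omega> n" for z n
  proof (rule ccontr)
    assume "\<not> cmod z < R + 1"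
    then have "1 \<le> cmod (z - X k \<omega>)" if "k \<in> {1..n}" for k
      using R[of "X k \<omega>"] norm_triangle_ineq2[of z "X k \<omega>"] assms that
      by (force simp: typical_def)
    then have "1 \<le> (\<Prod>k=1..n. cmod (z - X k \<omega>))"
      by (intro prod_ge_1) auto
    with z show False by (simp add: lemniscate_def random_poly_def prod_norm[symmetric])
  qed
  then show ?thesis
    unfolding bounded_iff by (intro exI[of _ "R + 1"]) force
qed

lemma typical_limsup_inradius:
  assumes x: "typical (\<lambda>k. X k \<omega>)" and S_neg: "S \<subseteq> neg_potential_set \<mu>"
  shows "limsup (\<lambda>n. inradius (lemniscate X \<omega> n)) \<le> inradius (neg_potential_set \<mu>)"
proof (rule ccontr)
  assume "\<not> ?thesis"
  then obtain y where y: "inradius (neg_potential_set \<mu>) < y" 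
    "y < limsup (\<lambda>n. inradius (lemniscate X \<omega> n))"
    using dense not_le by metis
  then have "y < top" using less_top top.extremum_strict by fastforce
  then obtain r where r: "y = ennreal r" "r \<ge> 0" by (cases y) auto
  \<comment> \<open>Positivity puts the centres themselves into the lemniscates, which bounds
    them.\<close>
  have "r > 0" using y(1) r by (metis ennreal_0 not_less_zero order_le_less)
  have "\<exists>\<^sub>F n in sequentially. y < inradius (lemniscate X \<omega> n)"
  proof (rule ccontr)
    assume "\<not> ?thesis"
    then have "limsup (\<lambda>n. inradius (lemniscate X \<omega> n)) \<le> y"
      by (intro Limsup_bounded) (simp add: frequently_def not_less)
    with y(2) show False by simp
  qed
  then have "infinite {n. y < inradius (lemniscate X \<omega> n)}"
    by (simp add: cofinite_eq_sequentially[symmetric] frequently_cofinite)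
  then obtain s :: "nat \<Rightarrow> nat" where s: "strict_mono s"
    "\<And>i. y < inradius (lemniscate X \<omega> (s i))"
    using infinite_enumerate by (metis mem_Collect_eq)
  have "\<exists>c. ball c r \<subseteq> lemniscate X \<omega> (s i)" for i
    using s(2)[of i] less_inradiusE r by metis
  then obtain c where c: "\<And>i. ball (c i) r \<subseteq> lemniscate X \<omega> (s i)" by metis
  have "range c \<subseteq> (\<Union>n. lemniscate X \<omega> n)"
  proof safe
    fix i
    have "c i \<in> lemniscate X \<omega> (s i)" using c \<open>r > 0\<close> centre_in_ball by blast
    then show "c i \<in> (\<Union>n. lemniscate X \<omega> n)" by blast
  qed
  then have "bounded (range c)"
    using lemniscate_bounded[of X \<omega>, OF x] bounded_subset by blast
  then obtain c0 t where t: "strict_mono (t :: nat \<Rightarrow> nat)" "(c \<circ> t) \<longlonglongrightarrow> c0"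
    using bounded_imp_convergent_subsequence by blast
  \<comment> \<open>A fixed \<open>z\<close> in the open limit disk lies in all late disks of the
    subsequence, so pointwise exclusion from the lemniscates suffices. A positive potential forces
    \<open>z\<close> off the support by \<open>S_neg\<close>.\<close>
  have "log_potential \<mu> z \<le> 0" if z: "z \<in> ball c0 r" for z
  proof (rule ccontr)
    assume "\<not> log_potential \<mu> z \<le> 0"
    then have "\<forall>\<^sub>F n in sequentially. z \<notin> lemniscate X \<omega> n"
      using S_neg by (intro typical_eventually_notin_lemniscate x) (auto simp: neg_potential_set_def)
    then have ev: "\<forall>\<^sub>F i in sequentially. z \<notin> lemniscate X \<omega> ((s \<circ> t) i)"
      by (rule eventually_compose_filterlim) (rule filterlim_subseq[OF strict_mono_o[OF s(1) t(1)]])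
    have "(\<lambda>i. dist ((c \<circ> t) i) z) \<longlonglongrightarrow> dist c0 z"
      by (intro tendsto_intros t)
    then have "\<forall>\<^sub>F i in sequentially. dist ((c \<circ> t) i) z < r"
      using z by (intro order_tendstoD(2)) auto
    with ev have "\<forall>\<^sub>F i in sequentially. False"
      by eventually_elim (use c in force)
    then show False by simp
  qed
  then have "ball c0 r \<subseteq> neg_potential_set \<mu>"
    by (rule ball_subset_neg_potential[OF S_neg])
  then have "y \<le> inradius (neg_potential_set \<mu>)"
    unfolding r(1) by (rule ennreal_le_inradius)
  with y(1) show False by simp
qed

section \<open>Almost sure typicality and conclusion\<close>

text \<open>Countably many almost sure events suffice: one for each \<open>k\<close>, and one for
  each \<open>m\<close> and each point of a countable dense set.\<close>

lemma AE_typical: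
  fixes X :: "nat \<Rightarrow> 'b \<Rightarrow> complex"
  assumes "prob_space M" "prob_space.indep_vars M (\<lambda>_. borel) X {1..}"
    and distr: "\<And>k. k \<ge> 1 \<Longrightarrow> distr M borel (X k) = \<mu>"
  shows "AE \<omega> in M. typical (\<lambda>k. X k \<omega>)"
proof -
  interpret M: prob_space M by fact
  have [measurable]: "X k \<in> borel_measurable M" if "k \<ge> 1" for k
    using assms(2) that by (simp add: M.indep_vars_def)
  have S_borel: "S \<in> sets borel" using S_sets sets_borel by simp
  have in_S: "AE \<omega> in M. X k \<omega> \<in> S" if "k \<ge> 1" for k
  proof -
    have "AE w in distr M borel (X k). w \<in> S"
      unfolding distr[OF that] by (rule AE_support)
    then show ?thesis
      using that S_borel by (subst (asm) AE_distr_iff) auto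
  qed
  have slln: "AE \<omega> in M. (\<lambda>n. (\<Sum>k=1..n. trunc_log m (cmod (z - X k \<omega>))) / real n)
      \<longlonglongrightarrow> trunc_potential m z" for m z
  proof -
    have "bounded ((\<lambda>w. trunc_log m (cmod (z - w))) ` S)"
      by (intro compact_imp_bounded compact_continuous_image continuous_intros compact_support)
    then obtain B where B: "\<And>w. w \<in> S \<Longrightarrow> \<bar>trunc_log m (cmod (z - w))\<bar> \<le> B"
      by (auto simp: bounded_iff)
    show ?thesis
    proof (rule M.bounded_strong_law)
      show "M.indep_vars (\<lambda>_. borel) (\<lambda>k \<omega>. trunc_log m (cmod (z - X k \<omega>))) {1..}"
        by (rule M.indep_vars_compose2[OF assms(2)]) measurable
      fix k :: nat assume k: "k \<ge> 1"
      show "AE \<omega> in M. \<bar>trunc_log m (cmod (z - X k \<omega>))\<bar> \<le> B"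
        using in_S[OF k] by eventually_elim (rule B)
      have "trunc_potential m z = (LINT w|distr M borel (X k). trunc_log m (cmod (z - w)))"
        by (simp add: trunc_potential_def distr[OF k])
      also have "\<dots> = M.expectation (\<lambda>\<omega>. trunc_log m (cmod (z - X k \<omega>)))"
        using k by (intro integral_distr) auto
      finally show "M.expectation (\<lambda>\<omega>. trunc_log m (cmod (z - X k \<omega>))) = trunc_potential m z" ..
    qed
  qed
  obtain D :: "complex set" where D: "countable D"
    "\<And>A. open A \<Longrightarrow> A \<noteq> {} \<Longrightarrow> \<exists>d\<in>D. d \<in> A"
    using countable_dense_setE by blast
  have "AE \<omega> in M. \<forall>k\<in>{1..}. X k \<omega> \<in> S"
    using in_S by (intro AE_ball_countable') auto
  moreover have "AE \<omega> in M. \<forall>d\<in>D. \<forall>m. (\<lambda>n. (\<Sum>k=1..n. trunc_log m (cmod (d - X k \<omega>))) / real n)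
      \<longlonglongrightarrow> trunc_potential m d"
    using slln D(1) by (intro AE_ball_countable') (auto simp: AE_all_countable)
  ultimately show ?thesis
    by eventually_elim (rule typicalI_dense[OF _ D(2)], auto)
qed

end

theorem corollary1p2:
  fixes \<mu> :: "complex measure"
    and M :: "'a measure"
    and X :: "nat \<Rightarrow> 'a \<Rightarrow> complex"
  assumes "prob_space \<mu>"
    and "sets \<mu> = sets borel"
    and "compact (measure_support \<mu>)"
    and "log_sq_locally_bounded \<mu>"
    and "neg_potential_set \<mu> \<noteq> {}"
    and "prob_space M"
    and "prob_space.indep_vars M (\<lambda>_. borel) X {1..}"
    and "\<And>k. k \<ge> 1 \<Longrightarrow> distr M borel (X k) = \<mu>"
  shows "(AE \<omega> in M.
            inradius (neg_potential_set \<mu>) \<le> liminf (\<lambda>n. inradius (lemniscate X \<omega> n))) \<and>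
         (measure_support \<mu> \<subseteq> neg_potential_set \<mu> \<longrightarrow>
          (AE \<omega> in M.
            (\<lambda>n. inradius (lemniscate X \<omega> n)) \<longlonglongrightarrow> inradius (neg_potential_set \<mu>)))"
proof -
  interpret log_sq_measure \<mu>
    using assms by (intro log_sq_measure.intro log_sq_measure_axioms.intro)
  have AE: "AE \<omega> in M. typical (\<lambda>k. X k \<omega>)"
    using assms by (intro AE_typical)
  show ?thesis
  proof (intro conjI impI)
    show "AE \<omega> in M. inradius (neg_potential_set \<mu>) \<le> liminf (\<lambda>n. inradius (lemniscate X \<omega> n))"
      using AE by eventually_elim (rule typical_liminf_inradius)
    assume S_neg: "measure_support \<mu> \<subseteq> neg_potential_set \<mu>"
    show "AE \<omega> in M. (\<lambda>n. inradius (lemniscate X \<omega> n)) \<longlonglongrightarrow> inradius (neg_potential_set \<mu>)"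
      using AE
    proof eventually_elim
      case (elim \<omega>)
      let ?l = "\<lambda>n. inradius (lemniscate X \<omega> n)"
      have "limsup ?l \<le> inradius (neg_potential_set \<mu>)" "inradius (neg_potential_set \<mu>) \<le> liminf ?l"
        using elim S_neg by (auto intro: typical_limsup_inradius typical_liminf_inradius)
      then show ?case
        by (intro Liminf_eq_Limsup) (use Liminf_le_Limsup[of sequentially ?l] in auto)
    qed
  qed
qed

end
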